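(* Let $s\in\mathbb{C}$, $d>0$ and let $a,b\in\mathbb{C}$, $a\neq0$ (with $\Re a\ne0$, as required where $I_s$ is introduced), be such that $d_+=d$ and $d_-=1$. Denote by $\widetilde I_s(a,b,c,d)$ the holomorphic continuation of $I_s(a,b,c,d)$ in $s$. Then it holds, exponentially fast, $$\lim_{d\,\Im a+\Im b\to\infty}\widetilde I_s\big(a,b,\tfrac14,d\big)=-i\,\widetilde I_s(a,b,0,d).$$
   Context: For $z\in\mathbb{C}$ the fractional part is $\{z\}=\frac12+\frac{i}{2\pi}\log e^{-2\pi i(z-\frac12)}$, so that $\{z\}=\{\Re z\}+i\,\Im z$ and on $\mathbb{R}$ it is the usual fractional part; $\log$ is the principal logarithm (imaginary part in $(-\pi,\pi]$). $\mathrm{sgn}(x)=1$ for $x\ge0$ and $-1$ for $x<0$. For $a,b,c\in\mathbb{C}$ with $\Re a\ne0$ and $d>0$, put $$d_+=\begin{cases}-\frac{\Im b}{\Im a},&\text{if }\Im a\neq0\text{ and }-\frac{\Im b}{\Im a}>d,\\ d,&\text{otherwise},\end{cases}\qquad d_-=\begin{cases}1,&\text{if }\Im a=\Im b=0,\\ \mathrm{sgn}(2d_+\Im a+\Im b),&\text{otherwise},\end{cases}$$ and, for $\Re s>-1$, $$I_s(a,b,c,d)=\cos(2\pi c)\int_d^\infty\pi\Big(\tfrac12-\{ax+b\}+i(x\,\Im a+\Im b)\Big)x^{-s-1}\,dx$$ $$-\sin(2\pi c)\int_d^\infty\Big(\tfrac12\log\big(4(\sin(\pi(ax+b)))^2\big)-\pi\,|x\,\Im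 a+\Im b|\Big)x^{-s-1}\,dx.$$ The function $I_s(a,b,c,d)$ extends holomorphically in $s$ to all of $\mathbb{C}$.
   Formalization: The limit is taken with a, b, d varying in any way, under the added condition that d, 1/d and 1/|a| grow slower than every exponential of d Im a + Im b (automatic when the other parameters are fixed); without it the claim fails, e.g. s=-1, d=1, b=iY, a=exp(-exp Y). *)

theory Defs
  imports "HOL-Complex_Analysis.Complex_Analysis" "HOL-Library.Landau_Symbols"
begin

text \<open>On the reals this agrees with \<^const>\<open>frac\<close>; the principal branch of
  \<^const>\<open>Ln\<close> has imaginary part in the interval from \<open>-\<pi>\<close> (excluded) to \<open>\<pi>\<close> (included).\<close>

definition cfrac :: "complex \<Rightarrow> complex" where
  "cfrac z = 1 / 2 + \<i> / (2 * of_real pi) * Ln (exp (- 2 * of_real pi * \<i> * (z - 1 / 2)))"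

text \<open>Unlike \<^const>\<open>sgn\<close>, this sign takes the value 1 at 0.\<close>

definition sgn1 :: "real \<Rightarrow> real" where
  "sgn1 x = (if x \<ge> 0 then 1 else - 1)"

definition d_plus :: "complex \<Rightarrow> complex \<Rightarrow> real \<Rightarrow> real" where
  "d_plus a b d = (if Im a \<noteq> 0 \<and> - Im b / Im a > d then - Im b / Im a else d)"

definition d_minus :: "complex \<Rightarrow> complex \<Rightarrow> real \<Rightarrow> real" where
  "d_minus a b d =
     (if Im a = 0 \<and> Im b = 0 then 1 else sgn1 (2 * d_plus a b d * Im a + Im b))"

text \<open>For \<open>-1 < Re s \<le> 0\<close> the integrals over the half-line converge only conditionally in
  general. The gauge integral over \<open>{d..}\<close> is the limit of the integrals over \<open>{d..T}\<close>
  as \<open>T\<close> tends to infinity, so it covers that case. The formula is meaningful for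
  \<open>Re s > -1\<close> only.\<close>

definition I_int :: "complex \<Rightarrow> complex \<Rightarrow> complex \<Rightarrow> complex \<Rightarrow> real \<Rightarrow> complex" where
  "I_int s a b c d =
     cos (2 * of_real pi * c) *
       integral {d..} (\<lambda>x::real.
         of_real pi * (1 / 2 - cfrac (a * of_real x + b) + \<i> * of_real (x * Im a + Im b))
           * of_real x powr (- s - 1))
   - sin (2 * of_real pi * c) *
       integral {d..} (\<lambda>x::real.
         (1 / 2 * Ln (4 * (sin (of_real pi * (a * of_real x + b)))\<^sup>2)
            - of_real (pi * \<bar>x * Im a + Im b\<bar>))
           * of_real x powr (- s - 1))"

text \<open>The entire continuation in \<open>s\<close>; it is unique by the identity theorem.\<close>

definition I_cont :: "complex \<Rightarrow> complex \<Rightarrow> complex \<Rightarrow> complex \<Rightarrow> real \<Rightarrow> complex" where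
  "I_cont s a b c d =
     (THE g. g holomorphic_on UNIV \<and> (\<forall>z. Re z > - 1 \<longrightarrow> g z = I_int z a b c d)) s"

end

theory Submission
  imports Defs
begin

text \<open>Write \<open>y = d * Im a + Im b\<close>, \<open>w = a * x + b\<close> and \<open>q = exp (2 * pi * \<i> * w)\<close>. As soon as
  \<open>y > 0\<close>, the condition \<open>d_plus a b d = d\<close> forces \<open>Im a \<ge> 0\<close>, hence \<open>Im w \<ge> y\<close> and
  \<open>|q| \<le> exp (- 2 * pi * y)\<close> on the whole half-line \<open>x \<ge> d\<close>. There the integrand for \<open>c = 0\<close> is
  the sawtooth \<open>S = pi * (1 / 2 - frac (Re w))\<close> times \<open>x powr (- s - 1)\<close> (lemma \<open>cfrac_eq\<close>), and
  the exact identity \<open>Ln (4 * sin (pi * w)\<^sup>2) = Ln (- 1 / q) + 2 * Ln (1 - q)\<close> of principal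
  logarithms (lemmas \<open>Ln_4_sin_squared\<close> and \<open>Ln_minus_exp\<close>) turns the one for \<open>c = 1 / 4\<close> into
  \<open>- (\<i> * S + Ln (1 - q))\<close> times the same power. So the difference to be estimated is, up to sign,
  the continuation of the integral of \<open>Ln (1 - q) * x powr (- s - 1)\<close>.

  For \<open>Re s > -1\<close> and \<open>Im a > 0\<close> its smallness would be immediate, but \<open>Im a\<close> may be zero or
  arbitrarily small and \<open>s\<close> is arbitrary. Therefore the continuation is made explicit by repeated
  integration by parts, in the locale \<open>antiderivative_tower\<close>: if a function has bounded iterated
  antiderivatives, then \<open>m\<close> integrations by parts express the integral as boundary terms at \<open>d\<close>
  plus an integral that converges absolutely for \<open>Re s > - m\<close>. The sawtooth has the periodic Bernoulli
  functions as antiderivatives (\<open>sawtooth_tower\<close>); this shows that the definite description in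
  \<open>I_cont\<close> denotes the continuation. The function \<open>Ln (1 - q)\<close> has
  polylogarithms of \<open>q\<close>, divided by powers of \<open>2 * pi * \<i> * a\<close>, as antiderivatives
  (\<open>log_tower\<close>). All of these are \<open>O(|q|)\<close>, so the continuation is bounded by
  \<open>exp (- 2 * pi * y)\<close> times a fixed power of \<open>d + 1 / d + 1 / |a|\<close>
  (\<open>norm_I_cont_difference_le\<close>). By hypothesis that power is \<open>O(exp (pi * y))\<close>, which leaves the rate \<open>\<kappa> = pi\<close>.\<close>

section \<open>Integrals over a half-line against a complex power\<close>

text \<open>The integrals below converge only conditionally for \<open>-1 < Re s \<le> 0\<close>, so dominated
  convergence is not available. However, the gauge integral over an unbounded set
  is by construction a limit of integrals over boxes.\<close>

lemma has_integral_atLeast_limit: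
  fixes h :: "real \<Rightarrow> 'a::banach"
  assumes int: "\<And>T. T \<ge> d \<Longrightarrow> (h has_integral \<Phi> T) {d..T}"
    and lim: "(\<Phi> \<longlongrightarrow> L) at_top"
  shows "(h has_integral L) {d..}"
  unfolding has_integral_alt'
proof (intro conjI allI impI)
  fix a b :: real
  have "h integrable_on {max a d..b}"
  proof (cases "d \<le> b")
    case True
    then show ?thesis
      by (intro integrable_on_subinterval[OF has_integral_integrable[OF int[OF True]]]) auto
  qed auto
  moreover have "{d..} \<inter> cbox a b = {max a d..b}" by auto
  ultimately show "(\<lambda>x. if x \<in> {d..} then h x else 0) integrable_on cbox a b"
    by (simp only: integrable_restrict_Int)
next
  fix e :: real assume "e > 0"
  with lim obtain N where N: "\<And>T. T \<ge> N \<Longrightarrow> dist (\<Phi> T) L < e"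
    unfolding tendsto_iff eventually_at_top_linorder by blast
  define B where "B = \<bar>d\<bar> + \<bar>N\<bar> + 1"
  show "\<exists>B>0. \<forall>a b. ball 0 B \<subseteq> cbox a b \<longrightarrow>
          norm (integral (cbox a b) (\<lambda>x. if x \<in> {d..} then h x else 0) - L) < e"
  proof (intro exI[of _ B] conjI allI impI)
    fix a b :: real assume sub: "ball 0 B \<subseteq> cbox a b"
    have "\<bar>d\<bar> + \<bar>N\<bar> \<in> ball 0 B" "- (\<bar>d\<bar> + \<bar>N\<bar>) \<in> ball 0 B"
      by (auto simp: B_def dist_real_def)
    with sub have "\<bar>d\<bar> + \<bar>N\<bar> \<in> cbox a b" "- (\<bar>d\<bar> + \<bar>N\<bar>) \<in> cbox a b" by blast+
    then have ab: "a \<le> d" "d \<le> b" "N \<le> b" by auto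
    then have "{d..} \<inter> cbox a b = {d..b}" by auto
    then have "integral (cbox a b) (\<lambda>x. if x \<in> {d..} then h x else 0) = integral {d..b} h"
      by (simp only: integral_restrict_Int)
    also have "\<dots> = \<Phi> b" using int[OF ab(2)] by (rule integral_unique)
    finally show "norm (integral (cbox a b) (\<lambda>x. if x \<in> {d..} then h x else 0) - L) < e"
      using N[OF ab(3)] by (simp add: dist_norm)
  qed (auto simp: B_def)
qed

definition tail_mellin :: "(real \<Rightarrow> complex) \<Rightarrow> real \<Rightarrow> complex \<Rightarrow> complex" where
  "tail_mellin f d s = integral {d..} (\<lambda>x. f x * of_real x powr (- s - 1))"

lemma norm_mellin_kernel:
  "x > 0 \<Longrightarrow> norm (complex_of_real x powr (- s - 1)) = x powr (- Re s - 1)"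
  by (simp add: norm_powr_real_powr)

lemma has_vector_derivative_powr_of_real:
  assumes "x > 0"
  shows "((\<lambda>x. complex_of_real x powr w) has_vector_derivative w * of_real x powr (w - 1)) (at x within S)"
  by (rule has_vector_derivative_real_field[OF has_field_derivative_powr])
     (use assms in \<open>simp add: complex_nonpos_Reals_iff\<close>)

lemma continuous_on_powr_of_real:
  assumes "S \<subseteq> {0<..}"
  shows "continuous_on S (\<lambda>x. complex_of_real x powr w)"
  by (rule continuous_on_vector_derivative)
     (use assms has_vector_derivative_powr_of_real in \<open>auto simp: subset_iff\<close>)

lemma
  assumes d: "d > 0" and s: "Re s > 0"
    and f: "continuous_on {d..} f" and bd: "\<And>x. x \<ge> d \<Longrightarrow> norm (f x) \<le> M"
  shows tail_mellin_integrable: "(\<lambda>x. f x * of_real x powr (- s - 1)) integrable_on {d..}"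
    and norm_tail_mellin_le: "norm (tail_mellin f d s) \<le> M * d powr (- Re s) / Re s"
proof -
  have g: "((\<lambda>x. M * x powr (- Re s - 1)) has_integral M * d powr (- Re s) / Re s) {d..}"
    using has_integral_mult_right[OF has_integral_powr_to_inf[of "- Re s - 1" d], of M] d s by simp
  have le: "norm (f x * of_real x powr (- s - 1)) \<le> M * x powr (- Re s - 1)" if "x \<in> {d..}" for x
    using that d bd[of x] by (simp add: norm_mult norm_mellin_kernel mult_right_mono)
  show int: "(\<lambda>x. f x * of_real x powr (- s - 1)) integrable_on {d..}"
  proof (rule integrable_on_all_intervals_integrable_bound[OF _ le])
    fix a b :: real
    have "continuous_on {max a d..b} (\<lambda>x. f x * of_real x powr (- s - 1))"
      using d by (intro continuous_intros continuous_on_subset[OF f] continuous_on_powr_of_real) auto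
    moreover have "{d..} \<inter> cbox a b = {max a d..b}" by auto
    ultimately show "(\<lambda>x. if x \<in> {d..} then f x * of_real x powr (- s - 1) else 0) integrable_on cbox a b"
      by (simp only: integrable_restrict_Int integrable_continuous_interval)
  qed (use g in auto)
  show "norm (tail_mellin f d s) \<le> M * d powr (- Re s) / Re s"
    using integral_norm_bound_integral[OF int has_integral_integrable[OF g] le] integral_unique[OF g]
    by (simp add: tail_mellin_def)
qed

text \<open>Together with the bound above, applied to the tail from \<open>T\<close>, this makes the integrals over
  \<open>{d..T}\<close> converge locally uniformly in \<open>s\<close> with the explicit rate \<open>M * T powr (- Re s) / Re s\<close>.\<close>

lemma tail_mellin_split:
  assumes d: "d > 0" and s: "Re s > 0" and T: "T \<ge> d"
    and f: "continuous_on {d..} f" and bd: "\<And>x. x \<ge> d \<Longrightarrow> norm (f x) \<le> M"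
  shows "tail_mellin f d s = integral {d..T} (\<lambda>x. f x * of_real x powr (- s - 1)) + tail_mellin f T s"
proof -
  let ?h = "\<lambda>x. f x * of_real x powr (- s - 1)"
  have "?h integrable_on {d..T}"
    using d by (intro integrable_continuous_interval continuous_intros continuous_on_subset[OF f]
        continuous_on_powr_of_real) auto
  moreover have "?h integrable_on {T..}"
    using d s T by (intro tail_mellin_integrable[where M = M] continuous_on_subset[OF f] bd) auto
  moreover have "negligible ({d..T} \<inter> {T..})"
    by (rule negligible_subset[of "{T}"]) auto
  ultimately have "(?h has_integral integral {d..T} ?h + integral {T..} ?h) ({d..T} \<union> {T..})"
    by (intro has_integral_Un integrable_integral)
  moreover have "{d..T} \<union> {T..} = {d..}" using T by auto
  ultimately show ?thesis
    unfolding tail_mellin_def by (simp only: integral_unique)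
qed

lemma tail_mellin_limit:
  assumes d: "d > 0" and s: "Re s > 0"
    and f: "continuous_on {d..} f" and bd: "\<And>x. x \<ge> d \<Longrightarrow> norm (f x) \<le> M"
  shows "((\<lambda>T. integral {d..T} (\<lambda>x. f x * of_real x powr (- s - 1))) \<longlongrightarrow> tail_mellin f d s) at_top"
proof -
  have lim: "((\<lambda>T. M * T powr (- Re s) / Re s) \<longlongrightarrow> 0) at_top"
    using s by real_asymp
  have "((\<lambda>T. tail_mellin f T s) \<longlongrightarrow> 0) at_top"
  proof (rule Lim_null_comparison[OF _ lim])
    show "\<forall>\<^sub>F T in at_top. norm (tail_mellin f T s) \<le> M * T powr (- Re s) / Re s"
      using eventually_ge_at_top[of d]
      by eventually_elim (use d s f bd in \<open>auto intro!: norm_tail_mellin_le intro: continuous_on_subset\<close>)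
  qed
  then have "((\<lambda>T. tail_mellin f d s - tail_mellin f T s) \<longlongrightarrow> tail_mellin f d s - 0) at_top"
    by (intro tendsto_intros)
  then have "((\<lambda>T. tail_mellin f d s - tail_mellin f T s) \<longlongrightarrow> tail_mellin f d s) at_top"
    by simp
  then show ?thesis
  proof (rule Lim_transform_eventually)
    show "\<forall>\<^sub>F T in at_top. tail_mellin f d s - tail_mellin f T s =
        integral {d..T} (\<lambda>x. f x * of_real x powr (- s - 1))"
      using eventually_ge_at_top[of d]
      by eventually_elim (use tail_mellin_split[OF d s _ f bd] in simp)
  qed
qed

lemma holomorphic_tail_mellin:
  assumes d: "d > 0"
    and f: "continuous_on {d..} f" and bd: "\<And>x. x \<ge> d \<Longrightarrow> norm (f x) \<le> M"
  shows "tail_mellin f d holomorphic_on {s. Re s > 0}"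
proof (rule holomorphic_uniform_sequence)
  define g where "g n s = integral {d..d + real n} (\<lambda>x. f x * of_real x powr (- s - 1))" for n s
  show "open {s. Re s > 0}" by (rule open_halfspace_Re_gt)
  show "g n holomorphic_on {s. Re s > 0}" for n
    unfolding g_def box_real[symmetric]
  proof (rule leibniz_rule_holomorphic)
    fix s :: complex and t assume "t \<in> cbox d (d + real n)"
    then have "t > 0" using d by auto
    then show "((\<lambda>s. f t * of_real t powr (- s - 1)) has_field_derivative
        f t * (- (Ln (of_real t) * of_real t powr (- s - 1)))) (at s within {s. Re s > 0})"
      by (auto simp: powr_def intro!: derivative_eq_intros)
  next
    fix s :: complex
    show "(\<lambda>t. f t * of_real t powr (- s - 1)) integrable_on cbox d (d + real n)"
      unfolding box_real
      using d by (intro integrable_continuous_interval continuous_intros continuous_on_subset[OF f]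
        continuous_on_powr_of_real) auto
  next
    have "continuous_on ({s. Re s > 0} \<times> {d..d + real n})
       (\<lambda>(s, t). f t * (- (of_real (ln t) * exp ((- s - 1) * of_real (ln t)))))"
      using d unfolding case_prod_unfold
      by (intro continuous_intros continuous_on_compose2[OF f]) auto
    then show "continuous_on ({s. Re s > 0} \<times> cbox d (d + real n))
       (\<lambda>(s, t). f t * (- (Ln (of_real t) * of_real t powr (- s - 1))))"
      unfolding box_real by (rule continuous_on_eq) (use d in \<open>auto simp: powr_def Ln_of_real\<close>)
  qed (rule convex_halfspace_Re_gt)
  fix s :: complex assume s: "s \<in> {s. Re s > 0}"
  define r where "r = Re s / 2"
  have r: "r > 0" using s by (simp add: r_def)
  have ge: "Re z \<ge> r" if "z \<in> cball s r" for z
    using that abs_Re_le_cmod[of "s - z"] by (simp add: r_def dist_norm)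
  have lim: "((\<lambda>n. M * (d + real n) powr (- r) / r) \<longlongrightarrow> 0) sequentially"
    using r by real_asymp
  have M: "M \<ge> 0" using bd[of d] norm_ge_zero[of "f d"] by linarith
  have "uniform_limit (cball s r) g (tail_mellin f d) sequentially"
  proof (rule uniform_limitI)
    fix e :: real assume "e > 0"
    with lim have "\<forall>\<^sub>F n in sequentially. M * (d + real n) powr (- r) / r < e"
      by (rule order_tendstoD)
    moreover have "\<forall>\<^sub>F n in sequentially. d + real n \<ge> 1" by real_asymp
    ultimately show "\<forall>\<^sub>F n in sequentially. \<forall>z\<in>cball s r. dist (g n z) (tail_mellin f d z) < e"
    proof (eventually_elim, intro ballI)
      fix n z assume n: "M * (d + real n) powr (- r) / r < e" "d + real n \<ge> 1" and z: "z \<in> cball s r"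
      have "dist (g n z) (tail_mellin f d z) = norm (tail_mellin f (d + real n) z)"
        using tail_mellin_split[OF d _ _ f bd, of z "d + real n"] ge[OF z] r
        by (simp add: g_def dist_norm)
      also have "\<dots> \<le> M * (d + real n) powr (- Re z) / Re z"
        using ge[OF z] r n d by (intro norm_tail_mellin_le continuous_on_subset[OF f] bd) auto
      also have "\<dots> \<le> M * (d + real n) powr (- r) / r"
        using ge[OF z] r n M by (intro frac_le mult_mono powr_mono) auto
      finally show "dist (g n z) (tail_mellin f d z) < e" using n by simp
    qed
  qed
  moreover have "cball s r \<subseteq> {s. Re s > 0}" using ge r by force
  ultimately show "\<exists>r. 0 < r \<and> cball s r \<subseteq> {s. Re s > 0} \<and> uniform_limit (cball s r) g (tail_mellin f d) sequentially"
    using r by blast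
qed

section \<open>Continuation by repeated integration by parts\<close>

text \<open>The hypothesis under which repeated integration by parts continues the integral of
  \<open>F 0 x * x powr (- s - 1)\<close> to all \<open>s\<close>: \<open>F 0\<close> has iterated antiderivatives that all stay bounded.
  Only \<open>F 0\<close> may jump, as the sawtooth does; the exceptional points must be finite in number on
  every bounded interval, so that the fundamental theorem of calculus applies.\<close>

locale antiderivative_tower =
  fixes d :: real and F :: "nat \<Rightarrow> real \<Rightarrow> complex" and M :: "nat \<Rightarrow> real"
  assumes d_pos: "d > 0"
    and bound: "\<And>k x. x \<ge> d \<Longrightarrow> norm (F k x) \<le> M k"
    and cont: "\<And>k. continuous_on {d..} (F (Suc k))"
    and deriv: "\<And>k. \<exists>S. (\<forall>T. finite (S \<inter> {d<..<T})) \<and>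
                  (\<forall>x. x > d \<longrightarrow> x \<notin> S \<longrightarrow> (F (Suc k) has_vector_derivative F k x) (at x))"
begin

lemma mellin_by_parts:
  assumes s: "Re s > - 1"
  shows "((\<lambda>x. F k x * of_real x powr (- s - 1)) has_integral
           (- F (Suc k) d * of_real d powr (- s - 1) + (s + 1) * tail_mellin (F (Suc k)) d (s + 1))) {d..}"
proof (rule has_integral_atLeast_limit)
  define K where "K x = complex_of_real x powr (- s - 1)" for x
  define \<Phi> where "\<Phi> T = F (Suc k) T * K T - F (Suc k) d * K d +
      (s + 1) * integral {d..T} (\<lambda>x. F (Suc k) x * of_real x powr (- (s + 1) - 1))" for T
  obtain S where fin: "\<And>T. finite (S \<inter> {d<..<T})"
    and S: "\<And>x. x > d \<Longrightarrow> x \<notin> S \<Longrightarrow> (F (Suc k) has_vector_derivative F k x) (at x)"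
    using deriv[of k] by blast
  fix T assume T: "T \<ge> d"
  define R where "R x = F (Suc k) x * of_real x powr (- (s + 1) - 1)" for x
  have "((\<lambda>x. F k x * K x - (s + 1) * R x) has_integral
      (F (Suc k) T * K T - F (Suc k) d * K d)) {d..T}"
  proof (rule fundamental_theorem_of_calculus_interior_strong[OF fin T])
    fix x assume x: "x \<in> {d<..<T} - (S \<inter> {d<..<T})"
    then have "x > 0" using d_pos by auto
    have K': "(K has_vector_derivative (- s - 1) * of_real x powr (- s - 1 - 1)) (at x)"
      unfolding K_def by (rule has_vector_derivative_powr_of_real) fact
    have "((\<lambda>x. F (Suc k) x * K x) has_vector_derivative
       F (Suc k) x * ((- s - 1) * of_real x powr (- s - 1 - 1)) + F k x * K x) (at x)"
      by (intro has_vector_derivative_mult S K') (use x in auto)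
    then show "((\<lambda>x. F (Suc k) x * K x) has_vector_derivative F k x * K x - (s + 1) * R x) (at x)"
      by (simp add: R_def algebra_simps)
  next
    show "continuous_on {d..T} (\<lambda>x. F (Suc k) x * K x)"
      unfolding K_def using d_pos
      by (intro continuous_intros continuous_on_subset[OF cont] continuous_on_powr_of_real) auto
  qed
  moreover have "(R has_integral integral {d..T} R) {d..T}"
    unfolding R_def using d_pos
    by (intro integrable_integral integrable_continuous_interval continuous_intros
        continuous_on_subset[OF cont] continuous_on_powr_of_real) auto
  from has_integral_mult_right[OF this]
  have "((\<lambda>x. (s + 1) * R x) has_integral (s + 1) * integral {d..T} R) {d..T}" .
  ultimately have "((\<lambda>x. (F k x * K x - (s + 1) * R x) + (s + 1) * R x) has_integral \<Phi> T) {d..T}"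
    unfolding \<Phi>_def R_def by (rule has_integral_add)
  then show "((\<lambda>x. F k x * of_real x powr (- s - 1)) has_integral \<Phi> T) {d..T}"
    by (simp add: K_def)
next
  define K where "K x = complex_of_real x powr (- s - 1)" for x
  let ?R = "\<lambda>x. F (Suc k) x * of_real x powr (- (s + 1) - 1)"
  have lim0: "((\<lambda>T. M (Suc k) * T powr (- Re s - 1)) \<longlongrightarrow> 0) at_top"
    using s by real_asymp
  have "((\<lambda>T. F (Suc k) T * K T) \<longlongrightarrow> 0) at_top"
  proof (rule Lim_null_comparison[OF _ lim0])
    show "\<forall>\<^sub>F T in at_top. norm (F (Suc k) T * K T) \<le> M (Suc k) * T powr (- Re s - 1)"
      using eventually_ge_at_top[of d]
    proof eventually_elim
      case (elim T)
      then show ?case using d_pos bound[of T "Suc k"]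
        by (simp add: norm_mult K_def norm_mellin_kernel mult_right_mono)
    qed
  qed
  moreover have "((\<lambda>T. integral {d..T} ?R) \<longlongrightarrow> tail_mellin (F (Suc k)) d (s + 1)) at_top"
    by (rule tail_mellin_limit[OF d_pos _ cont bound]) (use s in auto)
  ultimately have "((\<lambda>T. F (Suc k) T * K T - F (Suc k) d * K d + (s + 1) * integral {d..T} ?R)
      \<longlongrightarrow> 0 - F (Suc k) d * K d + (s + 1) * tail_mellin (F (Suc k)) d (s + 1)) at_top"
    by (intro tendsto_intros)
  then show "((\<lambda>T. F (Suc k) T * (of_real T powr (- s - 1)) - F (Suc k) d * (of_real d powr (- s - 1)) +
      (s + 1) * integral {d..T} ?R)
      \<longlongrightarrow> - F (Suc k) d * of_real d powr (- s - 1) + (s + 1) * tail_mellin (F (Suc k)) d (s + 1)) at_top"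
    by (simp add: K_def)
qed

text \<open>The result of \<open>m\<close> integrations by parts, started at \<open>F k\<close>. Each one lowers the abscissa of
  convergence by one, because the remaining integral is evaluated at \<open>s + 1\<close>. For \<open>m > 0\<close> the term
  makes sense on \<open>Re s > - m\<close>, where the integral of \<open>F k x * x powr (- s - 1)\<close> may diverge.\<close>

fun by_parts :: "nat \<Rightarrow> nat \<Rightarrow> complex \<Rightarrow> complex" where
  "by_parts 0 k s = tail_mellin (F k) d s"
| "by_parts (Suc m) k s =
     - F (Suc k) d * of_real d powr (- s - 1) + (s + 1) * by_parts m (Suc k) (s + 1)"

lemma holomorphic_by_parts: "by_parts m (Suc k) holomorphic_on {s. Re s > - real m}"
proof (induction m arbitrary: k)
  case 0
  have "tail_mellin (F (Suc k)) d holomorphic_on {s. Re s > 0}"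
    using d_pos cont bound by (rule holomorphic_tail_mellin)
  moreover have "by_parts 0 (Suc k) = tail_mellin (F (Suc k)) d" by (auto simp: fun_eq_iff)
  ultimately show ?case by simp
next
  case (Suc m)
  have "by_parts m (Suc (Suc k)) \<circ> (\<lambda>s. s + 1) holomorphic_on {s. Re s > - real (Suc m)}"
    by (intro holomorphic_on_compose_gen[OF _ Suc.IH]) (auto intro!: holomorphic_intros)
  then have *: "(\<lambda>s. by_parts m (Suc (Suc k)) (s + 1)) holomorphic_on {s. Re s > - real (Suc m)}"
    by (simp only: o_def)
  show ?case
    unfolding by_parts.simps by (intro holomorphic_intros *) (use d_pos in auto)
qed

text \<open>In the innermost term the remaining integral, at an argument with positive real part, is itself
  integrated by parts once more; this does not change its value.\<close>

lemma by_parts_Suc: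
  "Re s > - real (Suc m) \<Longrightarrow> by_parts (Suc (Suc m)) k s = by_parts (Suc m) k s"
proof (induction m arbitrary: k s)
  case 0
  then have "tail_mellin (F (Suc k)) d (s + 1) = by_parts 1 (Suc k) (s + 1)"
    unfolding tail_mellin_def using integral_unique[OF mellin_by_parts[of "s + 1" "Suc k"]]
    by simp
  then show ?case by simp
next
  case (Suc m)
  then have "by_parts (Suc (Suc m)) (Suc k) (s + 1) = by_parts (Suc m) (Suc k) (s + 1)"
    by (intro Suc.IH) simp
  then show ?case by simp
qed

lemma by_parts_eq:
  assumes "Re s > - real (Suc m)" "m \<le> n"
  shows "by_parts (Suc n) k s = by_parts (Suc m) k s"
  using assms(2)
proof (induction n rule: dec_induct)
  case (step n)
  then show ?case using by_parts_Suc[where m = n and s = s and k = k] assms(1) by (simp del: by_parts.simps)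
qed simp

text \<open>The number of integrations by parts is chosen just large enough for \<open>s\<close>; by the previous lemma
  any larger number gives the same value, so that the choice does not break holomorphy.\<close>

definition continuation :: "complex \<Rightarrow> complex" where
  "continuation s = by_parts (Suc (nat \<lceil>- Re s\<rceil>)) 0 s"

lemma continuation_eq:
  assumes "Re s > - real (Suc m)"
  shows "continuation s = by_parts (Suc m) 0 s"
proof -
  have "Re s > - real (Suc (nat \<lceil>- Re s\<rceil>))" by linarith
  then show ?thesis
    unfolding continuation_def
    using by_parts_eq[of m s] by_parts_eq[of "nat \<lceil>- Re s\<rceil>" s] assms
    by (metis nle_le)
qed

lemma holomorphic_continuation: "continuation holomorphic_on UNIV"
proof -
  have "continuation holomorphic_on {s. Re s > - real (Suc m)}" for m
  proof -
    have "by_parts m (Suc 0) \<circ> (\<lambda>s. s + 1) holomorphic_on {s. Re s > - real (Suc m)}"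
      by (intro holomorphic_on_compose_gen[OF _ holomorphic_by_parts]) (auto intro!: holomorphic_intros)
    then have *: "(\<lambda>s. by_parts m (Suc 0) (s + 1)) holomorphic_on {s. Re s > - real (Suc m)}"
      by (simp only: o_def)
    have "by_parts (Suc m) 0 holomorphic_on {s. Re s > - real (Suc m)}"
      unfolding by_parts.simps by (intro holomorphic_intros *) (use d_pos in auto)
    then show ?thesis
      by (rule holomorphic_transform) (simp add: continuation_eq del: by_parts.simps)
  qed
  then have "continuation holomorphic_on (\<Union>m. {s. Re s > - real (Suc m)})"
    by (intro holomorphic_on_UN_open open_halfspace_Re_gt)
  moreover have "(\<Union>m. {s. Re s > - real (Suc m)}) = UNIV"
  proof -
    have "\<exists>m. Re s > - real (Suc m)" for s
      using reals_Archimedean2[of "- Re s"] by (metis add.inverse_inverse less_SucI neg_less_iff_less of_nat_less_iff order_less_trans lessI)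
    then show ?thesis by auto
  qed
  ultimately show ?thesis by simp
qed

lemma has_integral_continuation:
  assumes "Re s > - 1"
  shows "((\<lambda>x. F 0 x * of_real x powr (- s - 1)) has_integral continuation s) {d..}"
  using mellin_by_parts[OF assms, of 0] continuation_eq[of 0 s] assms by simp

end

text \<open>The dependence on \<open>s\<close> of the bound below. It does not involve the tower or \<open>d\<close>, which is what
  makes the final estimate uniform in the parameters.\<close>

fun growth_const :: "nat \<Rightarrow> complex \<Rightarrow> real" where
  "growth_const 0 s = 1 / Re s"
| "growth_const (Suc m) s = 1 + norm (s + 1) * growth_const m (s + 1)"

lemma growth_const_nonneg: "Re s > - real m \<Longrightarrow> growth_const m s \<ge> 0"
  by (induction m arbitrary: s) auto

lemma powr_le_powr_abs:
  fixes d D t u :: real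
  assumes "d > 0" "d \<le> D" "1 / d \<le> D" "1 \<le> D" "\<bar>t\<bar> \<le> u"
  shows "d powr t \<le> D powr u"
proof (cases "t \<ge> 0")
  case True
  then have "d powr t \<le> D powr t" using assms by (intro powr_mono2) auto
  also have "\<dots> \<le> D powr u" using assms by (intro powr_mono) auto
  finally show ?thesis .
next
  case False
  then have "d powr t = (1 / d) powr (- t)" using assms by (simp add: powr_divide powr_minus_divide)
  also have "\<dots> \<le> D powr (- t)" using False assms by (intro powr_mono2) auto
  also have "\<dots> \<le> D powr u" using assms by (intro powr_mono) auto
  finally show ?thesis .
qed

text \<open>Every boundary term and the last integral carry a factor \<open>M k\<close> and a power of \<open>d\<close>. Powers of
  \<open>d\<close> of either sign are dominated by powers of a single \<open>D\<close> above both \<open>d\<close> and \<open>1 / d\<close>. The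
  case \<open>k = m = 0\<close> is excluded because it would bound an integral of the possibly discontinuous \<open>F 0\<close>.\<close>

lemma (in antiderivative_tower) norm_by_parts_le:
  assumes D: "d \<le> D" "1 / d \<le> D" "1 \<le> D" and M: "\<And>k. M k \<le> e * D ^ k" and "e \<ge> 0"
    and s: "Re s > - real m" and "k > 0 \<or> m > 0"
  shows "norm (by_parts m k s) \<le> e * D powr (real k + 2 * real m + \<bar>Re s\<bar>) * growth_const m s"
  using s \<open>k > 0 \<or> m > 0\<close>
proof (induction m arbitrary: k s)
  case 0
  then obtain j where k: "k = Suc j" by (cases k) auto
  have "norm (by_parts 0 k s) \<le> M k * d powr (- Re s) / Re s"
    using norm_tail_mellin_le[OF d_pos _ cont bound] 0 by (simp add: k)
  also have "\<dots> \<le> (e * D ^ k) * D powr \<bar>Re s\<bar> / Re s"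
    using 0 D d_pos \<open>e \<ge> 0\<close>
    by (intro divide_right_mono mult_mono M powr_le_powr_abs) auto
  also have "\<dots> = e * D powr (real k + \<bar>Re s\<bar>) / Re s"
    using D powr_realpow[of D k] by (simp add: powr_add)
  finally show ?case by simp
next
  case (Suc m)
  define N where "N = real k + 2 * real (Suc m) + \<bar>Re s\<bar>"
  have "norm (F (Suc k) d * of_real d powr (- s - 1)) \<le> M (Suc k) * d powr (- Re s - 1)"
    using d_pos bound[of d "Suc k"] by (simp add: norm_mult norm_mellin_kernel mult_right_mono)
  also have "\<dots> \<le> (e * D ^ Suc k) * D powr (\<bar>Re s\<bar> + 1)"
    using D d_pos \<open>e \<ge> 0\<close> by (intro mult_mono M powr_le_powr_abs) auto
  also have "\<dots> = e * D powr (real k + 2 + \<bar>Re s\<bar>)"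
    using D powr_add[of D "real (Suc k)" "\<bar>Re s\<bar> + 1"] powr_realpow[of D "Suc k"]
    by (simp add: add_ac)
  also have "\<dots> \<le> e * D powr N"
    using D \<open>e \<ge> 0\<close> by (intro mult_left_mono powr_mono) (auto simp: N_def)
  finally have 1: "norm (F (Suc k) d * of_real d powr (- s - 1)) \<le> e * D powr N" .
  have s1: "Re (s + 1) > - real m" using Suc.prems by simp
  have "norm (by_parts m (Suc k) (s + 1))
      \<le> e * D powr (real (Suc k) + 2 * real m + \<bar>Re (s + 1)\<bar>) * growth_const m (s + 1)"
    by (rule Suc.IH[OF s1]) simp
  also have "\<dots> \<le> e * D powr N * growth_const m (s + 1)"
    using D \<open>e \<ge> 0\<close> growth_const_nonneg[OF s1]
    by (intro mult_right_mono mult_left_mono powr_mono) (auto simp: N_def)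
  finally have 2: "norm ((s + 1) * by_parts m (Suc k) (s + 1))
      \<le> norm (s + 1) * (e * D powr N * growth_const m (s + 1))"
    unfolding norm_mult by (rule mult_left_mono) simp
  have "norm (by_parts (Suc m) k s)
      \<le> e * D powr N + norm (s + 1) * (e * D powr N * growth_const m (s + 1))"
    unfolding by_parts.simps by (intro norm_triangle_le add_mono 2) (use 1 in simp)
  then show ?case by (simp add: N_def algebra_simps)
qed

section \<open>Iterated antiderivatives of the sawtooth\<close>

text \<open>Mean zero is what makes an antiderivative periodic, and normalising its mean to zero allows the
  step to be iterated.\<close>

lemma periodic_antiderivative:
  fixes f :: "real \<Rightarrow> real"
  assumes cont: "continuous_on UNIV f" and per: "\<And>x. f (x + 1) = f x"
    and mean: "integral {0..1} f = 0"
  obtains g where "\<And>x. (g has_real_derivative f x) (at x)" "\<And>x. g (x + 1) = g x"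
    "integral {0..1} g = 0"
proof -
  have "\<exists>G. \<forall>x :: real. - \<infinity> < ereal x \<longrightarrow> ereal x < \<infinity> \<longrightarrow> (G has_vector_derivative f x) (at x)"
    using cont by (intro einterval_antiderivative) (auto simp: continuous_on_eq_continuous_at)
  then obtain G where G: "(G has_real_derivative f x) (at x)" for x
    by (auto simp: has_real_derivative_iff_has_vector_derivative)
  have "(f has_integral (G 1 - G 0)) {0..1}"
    by (intro fundamental_theorem_of_calculus)
       (auto intro: has_field_derivative_at_within G simp flip: has_real_derivative_iff_has_vector_derivative)
  with mean have G01: "G 1 = G 0" by (simp add: integral_unique)
  have "((\<lambda>x. G (x + 1) - G x) has_real_derivative 0) (at x)" for x
    using DERIV_shift[of G "f (x + 1)" x 1] G[of "x + 1"] G[of x]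
    by (auto intro!: derivative_eq_intros simp: per)
  then have "G (x + 1) - G x = G (0 + 1) - G 0" for x
    by (intro DERIV_isconst_all[where f = "\<lambda>x. G (x + 1) - G x"]) auto
  then have Gper: "G (x + 1) = G x" for x using G01 by simp
  define g where "g x = G x - integral {0..1} G" for x
  have "continuous_on {0..1} G"
    by (rule DERIV_continuous_on) (auto intro: DERIV_subset G)
  then have "integral {0..1} g = 0"
    unfolding g_def by (subst integral_diff) (auto intro: integrable_continuous_interval)
  moreover have "(g has_real_derivative f x) (at x)" for x
    unfolding g_def using G[of x] by (auto intro!: derivative_eq_intros)
  moreover have "g (x + 1) = g x" for x by (simp add: g_def Gper)
  ultimately show ?thesis by (intro that)
qed

lemma bounded_of_periodic:
  fixes f :: "real \<Rightarrow> real"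
  assumes cont: "continuous_on UNIV f" and per: "\<And>x. f (x + 1) = f x"
  obtains M where "\<And>x. \<bar>f x\<bar> \<le> M"
proof -
  interpret periodic_fun_simple' f by standard (rule per)
  have "compact (f ` {0..1})"
    using cont by (intro compact_continuous_image continuous_on_subset[OF cont]) auto
  then obtain M where M: "\<And>y. y \<in> f ` {0..1} \<Longrightarrow> norm y \<le> M"
    using compact_imp_bounded bounded_iff by metis
  have "\<bar>f x\<bar> \<le> M" for x
  proof -
    have "f x = f (frac x + of_int \<lfloor>x\<rfloor>)" by (simp add: frac_def)
    also have "\<dots> = f (frac x)" by (rule plus_of_int)
    finally show ?thesis using M[of "f (frac x)"] frac_lt_1[of x] by (auto simp: less_imp_le)
  qed
  then show ?thesis by (rule that)
qed

text \<open>Up to the factor \<open>- 1 / 2\<close> this is the second periodic Bernoulli function. As an antiderivative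
  of the sawtooth \<open>1 / 2 - frac u\<close> it is written down explicitly, since the sawtooth is not
  continuous; the constant \<open>1 / 6\<close> gives it mean zero.\<close>

definition bernoulli2 :: "real \<Rightarrow> real" where
  "bernoulli2 u = (frac u * (1 - frac u) - 1 / 6) / 2"

lemma bernoulli2_deriv:
  assumes "u \<notin> \<int>"
  shows "(bernoulli2 has_real_derivative 1 / 2 - frac u) (at u)"
proof -
  have "(frac has_real_derivative 1) (at u)"
    unfolding frac_def
    using DERIV_diff[OF DERIV_ident floor_has_real_derivative[of u "\<lambda>x. x"]] assms by simp
  then show ?thesis
    unfolding bernoulli2_def by (auto intro!: derivative_eq_intros simp: field_simps)
qed

lemma continuous_bernoulli2: "continuous_on UNIV bernoulli2"
proof -
  have "isCont bernoulli2 u" for u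
  proof (cases "u \<in> \<int>")
    case False
    then show ?thesis using bernoulli2_deriv DERIV_isCont by blast
  next
    case True
    then obtain n where u: "u = of_int n" by (auto elim: Ints_cases)
    have le: "norm (frac v * (1 - frac v)) \<le> \<bar>v - u\<bar>" if "\<bar>v - u\<bar> < 1" for v
    proof -
      have "0 \<le> frac v * (1 - frac v)" using frac_lt_1[of v] by (simp add: less_imp_le)
      moreover have "frac v * (1 - frac v) \<le> frac v" by (simp add: mult_left_le)
      moreover have "frac v * (1 - frac v) \<le> 1 - frac v"
        using frac_lt_1[of v] by (simp add: mult_left_le_one_le less_imp_le)
      moreover have "frac v = v - u" if "v \<ge> u"
      proof -
        have "\<lfloor>v\<rfloor> = n" using that \<open>\<bar>v - u\<bar> < 1\<close> u by (intro floor_unique) auto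
        then show ?thesis by (simp add: frac_def u)
      qed
      moreover have "1 - frac v = u - v" if "v < u"
      proof -
        have "\<lfloor>v\<rfloor> = n - 1" using that \<open>\<bar>v - u\<bar> < 1\<close> u by (intro floor_unique) auto
        then show ?thesis by (simp add: frac_def u)
      qed
      ultimately show ?thesis by (cases "v \<ge> u") auto
    qed
    have "((\<lambda>v. frac v * (1 - frac v)) \<longlongrightarrow> 0) (at u)"
    proof (rule Lim_null_comparison)
      show "\<forall>\<^sub>F v in at u. norm (frac v * (1 - frac v)) \<le> \<bar>v - u\<bar>"
        using le by (auto simp: eventually_at dist_real_def intro!: exI[of _ 1])
      show "((\<lambda>v. \<bar>v - u\<bar>) \<longlongrightarrow> 0) (at u)"
        by (rule tendsto_eq_intros refl | simp)+
    qed
    then have "(bernoulli2 \<longlongrightarrow> (0 - 1 / 6) / 2) (at u)"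
      unfolding bernoulli2_def by (intro tendsto_intros) auto
    moreover have "bernoulli2 u = (0 - 1 / 6) / 2" using True by (simp add: bernoulli2_def)
    ultimately show ?thesis unfolding isCont_def by simp
  qed
  then show ?thesis by (simp add: continuous_on_eq_continuous_at)
qed

lemma integral_bernoulli2: "integral {0..1} bernoulli2 = 0"
proof -
  have "((\<lambda>u. (u * (1 - u) - 1 / 6) / 2) has_integral
      ((1^2 / 2 - 1^3 / 3 - 1 / 6) / 2 - (0^2 / 2 - 0^3 / 3 - 0 / 6) / 2)) {0..1::real}"
    by (intro fundamental_theorem_of_calculus)
       (auto intro!: derivative_eq_intros simp: field_simps power2_eq_square
          simp flip: has_real_derivative_iff_has_vector_derivative)
  then have "((\<lambda>u. (u * (1 - u) - 1 / 6) / 2) has_integral 0) {0..1::real}"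
    by simp
  moreover have "bernoulli2 u = (u * (1 - u) - 1 / 6) / 2" if "u \<in> {0..1}" for u
    using that by (cases "u = 1") (auto simp: bernoulli2_def)
  ultimately have "(bernoulli2 has_integral 0) {0..1}"
    by (subst has_integral_cong) auto
  then show ?thesis by (rule integral_unique)
qed

text \<open>Up to constant factors the functions \<open>P k\<close> are the periodic Bernoulli functions. Only the first
  step, from \<open>P 0\<close> to \<open>P 1\<close>, meets the jumps at the integers.\<close>

lemma sawtooth_antiderivatives:
  obtains P :: "nat \<Rightarrow> real \<Rightarrow> real" where
    "\<And>u. P 0 u = 1 / 2 - frac u"
    "\<And>k. continuous_on UNIV (P (Suc k))"
    "\<And>k. \<exists>M. \<forall>u. \<bar>P k u\<bar> \<le> M"
    "\<And>k u. u \<notin> \<int> \<Longrightarrow> (P (Suc k) has_real_derivative P k u) (at u)"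
proof -
  let ?ok = "\<lambda>f :: real \<Rightarrow> real. continuous_on UNIV f \<and> (\<forall>x. f (x + 1) = f x) \<and> integral {0..1} f = 0"
  have "\<exists>Q. \<forall>n. (?ok (Q n) \<and> (n = 0 \<longrightarrow> Q n = bernoulli2)) \<and>
      (\<forall>x. (Q (Suc n) has_real_derivative Q n x) (at x))"
  proof (rule dependent_nat_choice)
    show "\<exists>f. ?ok f \<and> (0 = 0 \<longrightarrow> f = bernoulli2)"
      using continuous_bernoulli2 integral_bernoulli2 by (auto simp: bernoulli2_def frac_1_eq)
  next
    fix f :: "real \<Rightarrow> real" and n :: nat
    assume "?ok f \<and> (n = 0 \<longrightarrow> f = bernoulli2)"
    then obtain g where g: "\<And>x. (g has_real_derivative f x) (at x)" "\<And>x. g (x + 1) = g x"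
        "integral {0..1} g = 0"
      using periodic_antiderivative[of f] by blast
    then have "continuous_on UNIV g"
      by (auto intro: DERIV_isCont simp: continuous_on_eq_continuous_at)
    with g show "\<exists>g. (?ok g \<and> (Suc n = 0 \<longrightarrow> g = bernoulli2)) \<and> (\<forall>x. (g has_real_derivative f x) (at x))"
      by blast
  qed
  then obtain Q where Q: "?ok (Q n)" "Q 0 = bernoulli2" "(Q (Suc n) has_real_derivative Q n x) (at x)" for n x
    by blast
  define P where "P k = (case k of 0 \<Rightarrow> \<lambda>u. 1 / 2 - frac u | Suc n \<Rightarrow> Q n)" for k
  show ?thesis
  proof (rule that)
    show "P 0 u = 1 / 2 - frac u" for u by (simp add: P_def)
    show "continuous_on UNIV (P (Suc k))" for k using Q by (simp add: P_def)
    show "\<exists>M. \<forall>u. \<bar>P k u\<bar> \<le> M" for k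
    proof (cases k)
      case 0
      have "\<bar>P k u\<bar> \<le> 1" for u
        using frac_ge_0[of u] frac_lt_1[of u] unfolding P_def 0 nat.case by linarith
      then show ?thesis by blast
    next
      case (Suc n)
      obtain M where "\<And>u. \<bar>Q n u\<bar> \<le> M" using bounded_of_periodic[of "Q n"] Q(1)[of n] by blast
      then show ?thesis by (auto simp: P_def Suc)
    qed
    show "(P (Suc k) has_real_derivative P k u) (at u)" if "u \<notin> \<int>" for k u
      using Q(2,3) bernoulli2_deriv[OF that] by (cases k) (auto simp: P_def)
  qed
qed

text \<open>Substituting \<open>\<alpha> * x + \<beta>\<close> costs a factor \<open>1 / \<alpha>\<close> per antiderivative. This tower continues the
  integral for \<open>c = 0\<close>. It cancels in the difference that is to be estimated, so
  its bounds need not be explicit.\<close>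

lemma sawtooth_tower:
  assumes \<alpha>: "\<alpha> \<noteq> 0" and d: "d > 0"
  obtains F M where "antiderivative_tower d F M"
    "\<And>x. F 0 x = of_real (pi * (1 / 2 - frac (\<alpha> * x + \<beta>)))"
proof -
  obtain P where P0: "\<And>u. P 0 u = 1 / 2 - frac u"
    and Pc: "\<And>k. continuous_on UNIV (P (Suc k))"
    and Pb: "\<And>k. \<exists>M. \<forall>u. \<bar>P k u\<bar> \<le> M"
    and Pd: "\<And>k u. u \<notin> \<int> \<Longrightarrow> (P (Suc k) has_real_derivative P k u) (at u)"
    using sawtooth_antiderivatives by blast
  define F where "F k x = complex_of_real (pi * P k (\<alpha> * x + \<beta>) / \<alpha> ^ k)" for k x
  obtain B where B: "\<And>k u. \<bar>P k u\<bar> \<le> B k" using Pb by metis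
  define S where "S = {x. \<alpha> * x + \<beta> \<in> \<int>}"
  have "antiderivative_tower d F (\<lambda>k. pi * B k / \<bar>\<alpha>\<bar> ^ k)"
  proof (unfold_locales, fact d)
    show "norm (F k x) \<le> pi * B k / \<bar>\<alpha>\<bar> ^ k" for k x
      unfolding F_def norm_of_real abs_divide abs_mult power_abs[symmetric]
      using B by (intro divide_right_mono mult_mono) auto
    show "continuous_on {d..} (F (Suc k))" for k
      unfolding F_def using \<alpha> by (intro continuous_intros continuous_on_compose2[OF Pc]) auto
    fix k
    have "finite (S \<inter> {d<..<T})" for T
    proof (rule finite_subset)
      let ?C = "\<bar>\<alpha>\<bar> * T + \<bar>\<beta>\<bar>"
      show "S \<inter> {d<..<T} \<subseteq> (\<lambda>n. (n - \<beta>) / \<alpha>) ` {n. n \<in> \<int> \<and> \<bar>n\<bar> \<le> ?C}"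
      proof
        fix x assume x: "x \<in> S \<inter> {d<..<T}"
        have "\<bar>\<alpha> * x + \<beta>\<bar> \<le> \<bar>\<alpha>\<bar> * \<bar>x\<bar> + \<bar>\<beta>\<bar>"
          by (metis abs_mult abs_triangle_ineq)
        also have "\<dots> \<le> ?C" using x d by (intro add_right_mono mult_left_mono) auto
        finally have "\<alpha> * x + \<beta> \<in> {n. n \<in> \<int> \<and> \<bar>n\<bar> \<le> ?C}" using x by (simp add: S_def)
        moreover have "x = (\<alpha> * x + \<beta> - \<beta>) / \<alpha>" using \<alpha> by simp
        ultimately show "x \<in> (\<lambda>n. (n - \<beta>) / \<alpha>) ` {n. n \<in> \<int> \<and> \<bar>n\<bar> \<le> ?C}" by blast
      qed
      show "finite ((\<lambda>n. (n - \<beta>) / \<alpha>) ` {n. n \<in> \<int> \<and> \<bar>n\<bar> \<le> ?C})"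
        by (intro finite_imageI finite_abs_int_segment)
    qed
    moreover have "(F (Suc k) has_vector_derivative F k x) (at x)" if "x \<notin> S" for x
    proof -
      have "((\<lambda>x. P (Suc k) (\<alpha> * x + \<beta>)) has_real_derivative P k (\<alpha> * x + \<beta>) * \<alpha>) (at x)"
        using that by (intro DERIV_chain2[OF Pd]) (auto simp: S_def intro!: derivative_eq_intros)
      then have "((\<lambda>x. pi * P (Suc k) (\<alpha> * x + \<beta>) / \<alpha> ^ Suc k) has_real_derivative
          pi * P k (\<alpha> * x + \<beta>) / \<alpha> ^ k) (at x)"
        using \<alpha> by (auto intro!: derivative_eq_intros simp: field_simps)
      then show ?thesis
        unfolding F_def by (intro has_vector_derivative_of_real) (simp add: has_real_derivative_iff_has_vector_derivative)
    qed
    ultimately show "\<exists>S. (\<forall>T. finite (S \<inter> {d<..<T})) \<and>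
        (\<forall>x. x > d \<longrightarrow> x \<notin> S \<longrightarrow> (F (Suc k) has_vector_derivative F k x) (at x))"
      by blast
  qed
  moreover have "F 0 x = of_real (pi * (1 / 2 - frac (\<alpha> * x + \<beta>)))" for x
    by (simp add: F_def P0)
  ultimately show ?thesis by (rule that)
qed

section \<open>Polylogarithms as iterated antiderivatives of the logarithm\<close>

text \<open>The polylogarithm of order \<open>k\<close>. For \<open>k > 0\<close> the term at \<open>n = 0\<close> vanishes, because
  \<open>1 / 0 = 0\<close>; for \<open>k = 0\<close> it does not.\<close>

definition polylog :: "nat \<Rightarrow> complex \<Rightarrow> complex" where
  "polylog k z = (\<Sum>n. 1 / of_nat n ^ k * z ^ n)"

lemma norm_polylog_coeff: "norm (1 / of_nat n ^ k :: complex) \<le> 1"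
  by (cases "n = 0"; cases "k = 0") (auto simp: norm_divide norm_power divide_le_eq_1)

lemma summable_polylog:
  assumes "norm z < 1"
  shows "summable (\<lambda>n. 1 / of_nat n ^ k * z ^ n :: complex)"
proof (rule summable_comparison_test)
  show "summable (\<lambda>n. norm z ^ n)" using assms by (simp add: summable_geometric)
  have "norm (1 / of_nat n ^ k :: complex) * norm z ^ n \<le> 1 * norm z ^ n" for n
    by (intro mult_right_mono norm_polylog_coeff) auto
  then show "\<exists>N. \<forall>n\<ge>N. norm (1 / of_nat n ^ k * z ^ n :: complex) \<le> norm z ^ n"
    by (simp only: norm_mult norm_power mult_1) blast
qed

lemma polylog_split_head:
  assumes "norm z < 1"
  shows "polylog (Suc k) z = (\<Sum>n. 1 / of_nat (Suc n) ^ Suc k * z ^ Suc n)"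
  unfolding polylog_def using suminf_split_head[OF summable_polylog[OF assms], of "Suc k"] by simp

lemma norm_polylog_le:
  assumes "norm z < 1"
  shows "norm (polylog (Suc k) z) \<le> norm z / (1 - norm z)"
proof -
  have "(\<lambda>n. norm z * norm z ^ n) sums (norm z * (1 / (1 - norm z)))"
    using assms by (intro sums_mult geometric_sums) simp
  then have s: "(\<lambda>n. norm z ^ Suc n) sums (norm z / (1 - norm z))" by simp
  have "norm (\<Sum>n. 1 / of_nat (Suc n) ^ Suc k * z ^ Suc n) \<le> (\<Sum>n. norm z ^ Suc n)"
  proof (rule norm_suminf_le)
    fix n
    have "norm (1 / of_nat (Suc n) ^ Suc k :: complex) * norm z ^ Suc n \<le> 1 * norm z ^ Suc n"
      by (intro mult_right_mono norm_polylog_coeff) auto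
    then show "norm (1 / of_nat (Suc n) ^ Suc k * z ^ Suc n :: complex) \<le> norm z ^ Suc n"
      by (simp only: norm_mult norm_power mult_1)
  qed (use s in \<open>rule sums_summable\<close>)
  then show ?thesis using s assms by (simp only: polylog_split_head[OF assms] sums_unique[symmetric])
qed

text \<open>The usual rule \<open>z * Li' = Li\<close> of one order lower is stated without dividing by \<open>z\<close>, so that it
  applies directly after the substitution \<open>z = exp (c * x)\<close>, whose derivative is \<open>c * z\<close>.\<close>

lemma polylog_deriv:
  assumes "norm z < 1"
  obtains D where "(polylog (Suc (Suc k)) has_field_derivative D) (at z)" "z * D = polylog (Suc k) z"
proof -
  define c where "c n = (1 / of_nat n ^ Suc (Suc k) :: complex)" for n
  obtain r where r: "norm z < r" "r < 1" using dense[OF assms] by blast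
  have "summable (\<lambda>n. c n * of_real r ^ n)"
    unfolding c_def using r order_trans[OF norm_ge_zero less_imp_le[OF r(1)]]
    by (intro summable_polylog) simp
  then have "((\<lambda>x. \<Sum>n. c n * x ^ n) has_field_derivative (\<Sum>n. diffs c n * z ^ n)) (at z)"
    by (rule termdiffs_strong) (use r in simp)
  moreover have "diffs c n = 1 / of_nat (Suc n) ^ Suc k" for n
    by (simp add: diffs_def c_def field_simps del: of_nat_Suc)
  ultimately have D: "(polylog (Suc (Suc k)) has_field_derivative (\<Sum>n. 1 / of_nat (Suc n) ^ Suc k * z ^ n)) (at z)"
    by (simp add: polylog_def[abs_def] c_def)
  show ?thesis
  proof (rule that[OF D])
    have "summable (\<lambda>n. 1 / of_nat (Suc n) ^ Suc k * z ^ n)"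
      using termdiff_converges[of z 1 c] assms summable_polylog[of _ "Suc (Suc k)"]
      by (simp add: \<open>\<And>n. diffs c n = _ n\<close> c_def)
    from suminf_mult[OF this, of z]
    show "z * (\<Sum>n. 1 / of_nat (Suc n) ^ Suc k * z ^ n) = polylog (Suc k) z"
      by (simp only: polylog_split_head[OF assms] power_Suc mult.left_commute[of z])
  qed
qed

lemma polylog_1: "norm z < 1 \<Longrightarrow> polylog (Suc 0) z = - Ln (1 - z)"
  using sums_minus[OF Ln_series'[of "- z"]] by (simp add: polylog_def sums_unique[symmetric])

text \<open>Along \<open>x\<close> the function \<open>q = exp (2 * pi * \<i> * (a * x + b))\<close> satisfies \<open>q' = c * q\<close> with
  \<open>c = 2 * pi * \<i> * a\<close>, so the iterated antiderivatives of \<open>Ln (1 - q)\<close> are the polylogarithms of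
  \<open>q\<close> divided by powers of \<open>c\<close>. Their bounds all contain the maximum of \<open>|q|\<close>, which is
  exponentially small. For \<open>Im a = 0\<close> there is no decay in \<open>x\<close>, and the continuation relies on
  the oscillation expressed by the division by \<open>c\<close>.\<close>

lemma log_tower:
  assumes d: "d > 0" and a: "a \<noteq> 0" "Im a \<ge> 0"
    and small: "exp (- 2 * pi * (d * Im a + Im b)) \<le> 1 / 2"
  obtains F where
    "antiderivative_tower d F (\<lambda>k. 2 * exp (- 2 * pi * (d * Im a + Im b)) / (2 * pi * norm a) ^ k)"
    "\<And>x. x \<ge> d \<Longrightarrow> F 0 x = Ln (1 - exp (2 * of_real pi * \<i> * (a * of_real x + b)))"
proof -
  define e where "e = exp (- 2 * pi * (d * Im a + Im b))"
  define c where "c = 2 * of_real pi * \<i> * a"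
  define q where "q x = exp (2 * of_real pi * \<i> * (a * of_real x + b))" for x :: real
  define F where "F k x = - polylog (Suc k) (q x) / c ^ k" for k x
  have c: "c \<noteq> 0" "norm c = 2 * pi * norm a" using a by (auto simp: c_def norm_mult)
  have q: "norm (q x) \<le> e" if "x \<ge> d" for x
  proof -
    have "d * Im a \<le> x * Im a" using that a by (intro mult_right_mono) auto
    then have "2 * pi * (d * Im a + Im b) \<le> 2 * pi * (x * Im a + Im b)" by simp
    then show ?thesis by (simp add: q_def e_def mult.commute)
  qed
  have q1: "norm (q x) < 1" if "x \<ge> d" for x using q[OF that] small by (simp add: e_def)
  have dq: "(q has_vector_derivative c * q x) (at x)" for x
  proof -
    have "((\<lambda>z. exp (2 * of_real pi * \<i> * (a * z + b))) has_field_derivative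
        c * exp (2 * of_real pi * \<i> * (a * of_real x + b))) (at (of_real x))"
      by (auto intro!: derivative_eq_intros simp: c_def)
    from has_vector_derivative_real_field[OF this] show ?thesis
      unfolding q_def[abs_def] .
  qed
  have dF: "(F (Suc k) has_vector_derivative F k x) (at x)" if x: "x \<ge> d" for k x
  proof -
    obtain D where D: "(polylog (Suc (Suc k)) has_field_derivative D) (at (q x))"
        "q x * D = polylog (Suc k) (q x)"
      using polylog_deriv[OF q1[OF x]] by blast
    have "((polylog (Suc (Suc k)) \<circ> q) has_vector_derivative c * q x * D) (at x)"
      by (rule field_vector_diff_chain_at[OF dq D(1)])
    moreover have "c * q x * D = c * polylog (Suc k) (q x)" by (simp add: D(2) mult.assoc)
    ultimately have "((\<lambda>x. (- 1 / c ^ Suc k) * polylog (Suc (Suc k)) (q x)) has_vector_derivative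
        (- 1 / c ^ Suc k) * (c * polylog (Suc k) (q x))) (at x)"
      by (intro has_vector_derivative_mult_right) (simp add: o_def)
    then show ?thesis using c by (simp add: F_def[abs_def])
  qed
  have "antiderivative_tower d F (\<lambda>k. 2 * e / (2 * pi * norm a) ^ k)"
  proof (unfold_locales, fact d)
    fix k x assume x: "x \<ge> d"
    have "norm (polylog (Suc k) (q x)) \<le> norm (q x) / (1 - norm (q x))"
      by (rule norm_polylog_le[OF q1[OF x]])
    also have "\<dots> \<le> e / (1 / 2)"
      using q[OF x] small by (intro frac_le) (auto simp: e_def)
    finally show "norm (F k x) \<le> 2 * e / (2 * pi * norm a) ^ k"
      using c by (auto simp: F_def norm_divide norm_power intro!: divide_right_mono)
  next
    fix k
    show "continuous_on {d..} (F (Suc k))"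
      by (rule continuous_on_vector_derivative) (auto intro: has_vector_derivative_at_within dF)
    show "\<exists>S. (\<forall>T. finite (S \<inter> {d<..<T})) \<and>
        (\<forall>x. x > d \<longrightarrow> x \<notin> S \<longrightarrow> (F (Suc k) has_vector_derivative F k x) (at x))"
      using dF by (intro exI[of _ "{}"]) auto
  qed
  moreover have "F 0 x = Ln (1 - q x)" if "x \<ge> d" for x
    using polylog_1[OF q1[OF that]] by (simp add: F_def)
  ultimately show ?thesis by (intro that[of F]) (auto simp: e_def q_def)
qed


section \<open>Principal logarithms in the upper half-plane\<close>

lemma Ln_minus_exp:
  "Ln (- exp (- 2 * of_real pi * \<i> * w)) = of_real (2 * pi * Im w) + \<i> * of_real (pi * (1 - 2 * frac (Re w)))"
proof (rule Ln_unique)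
  define n where "n = \<lfloor>Re w\<rfloor>"
  have w: "w = of_int n + of_real (frac (Re w)) + \<i> * of_real (Im w)"
    by (simp add: complex_eq_iff frac_def n_def)
  have "exp (of_real (2 * pi * Im w) + \<i> * of_real (pi * (1 - 2 * frac (Re w)))) =
        exp (- 2 * of_real pi * \<i> * w + \<i> * of_real pi + \<i> * (of_int n * (of_real pi * 2)))"
    by (subst (3) w) (simp add: algebra_simps)
  also have "\<dots> = - exp (- 2 * of_real pi * \<i> * w)"
    unfolding exp_plus_2pin by (simp only: exp_add exp_pi_i' mult_minus1_right)
  finally show "exp (of_real (2 * pi * Im w) + \<i> * of_real (pi * (1 - 2 * frac (Re w)))) =
      - exp (- 2 * of_real pi * \<i> * w)" .
  have "pi * (2 * frac (Re w)) < pi * 2" "0 \<le> pi * frac (Re w)" using frac_lt_1[of "Re w"] by auto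
  then show "- pi < Im (of_real (2 * pi * Im w) + \<i> * of_real (pi * (1 - 2 * frac (Re w))))"
      "Im (of_real (2 * pi * Im w) + \<i> * of_real (pi * (1 - 2 * frac (Re w)))) \<le> pi"
    by (simp_all add: algebra_simps)
qed

lemma cfrac_eq: "cfrac w = of_real (frac (Re w)) + \<i> * of_real (Im w)"
proof -
  have "exp (- 2 * of_real pi * \<i> * (w - 1 / 2)) = exp (- 2 * of_real pi * \<i> * w + of_real pi * \<i>)"
    by (simp add: algebra_simps)
  also have "\<dots> = - exp (- 2 * of_real pi * \<i> * w)"
    by (simp only: exp_add exp_pi_i mult_minus1_right)
  finally have shift: "exp (- 2 * of_real pi * \<i> * (w - 1 / 2)) = - exp (- 2 * of_real pi * \<i> * w)" .
  show ?thesis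
    unfolding cfrac_def shift Ln_minus_exp by (simp add: complex_eq_iff field_simps)
qed

text \<open>The two sides have the same exponential, since
  \<open>4 * sin (pi * w)\<^sup>2 = - exp (- 2 * pi * \<i> * w) * (1 - q)\<^sup>2\<close> with \<open>q = exp (2 * pi * \<i> * w)\<close>. No
  multiple of \<open>2 * pi * \<i>\<close> intervenes: the imaginary part \<open>pi * (1 - 2 * frac (Re w))\<close> of the first
  logarithm has the same sign as \<open>Im q\<close> unless \<open>q\<close> is real, whereas the argument of \<open>1 - q\<close> has the opposite sign
  and is below \<open>pi / 2\<close> in absolute value. So the sum stays in the principal strip.\<close>

lemma Ln_4_sin_squared:
  assumes w: "Im w > 0"
  shows "Ln (4 * (sin (of_real pi * w))\<^sup>2) =
         Ln (- exp (- 2 * of_real pi * \<i> * w)) + 2 * Ln (1 - exp (2 * of_real pi * \<i> * w))"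
proof (rule Ln_unique)
  define q where "q = exp (2 * of_real pi * \<i> * w)"
  define p where "p = exp (\<i> * (of_real pi * w))"
  have p: "p \<noteq> 0" "q = p ^ 2" "exp (- 2 * of_real pi * \<i> * w) = 1 / p ^ 2" "exp (- (\<i> * (of_real pi * w))) = 1 / p"
    by (auto simp: p_def q_def exp_minus inverse_eq_divide mult_ac simp flip: exp_double)
  have nq: "norm q < 1" using w by (simp add: q_def)
  then have q1: "1 - q \<noteq> 0" by auto
  have Re1: "Re (1 - q) > 0" using nq complex_Re_le_cmod[of q] by simp
  have "exp (Ln (- exp (- 2 * of_real pi * \<i> * w)) + 2 * Ln (1 - q))
      = - exp (- 2 * of_real pi * \<i> * w) * (1 - q) ^ 2"
    using q1 by (simp add: exp_add exp_double)
  also have "\<dots> = 4 * (sin (of_real pi * w))\<^sup>2"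
  proof -
    have sin: "sin (of_real pi * w) = (p - 1 / p) / (2 * \<i>)"
      by (simp only: sin_exp_eq p(4) p_def[symmetric])
    then show ?thesis
      using p(1) unfolding p(2,3) sin by (simp add: power2_eq_square field_simps)
  qed
  finally show "exp (Ln (- exp (- 2 * of_real pi * \<i> * w)) + 2 * Ln (1 - exp (2 * of_real pi * \<i> * w)))
      = 4 * (sin (of_real pi * w))\<^sup>2" by (simp only: q_def)
  define t where "t = frac (Re w)"
  have t: "0 \<le> t" "t < 1" unfolding t_def by (auto simp: frac_lt_1)
  have "Im q = exp (- 2 * pi * Im w) * sin (2 * pi * Re w)" by (simp add: q_def Im_exp)
  also have "sin (2 * pi * Re w) = sin (2 * pi * t + 2 * pi * of_int \<lfloor>Re w\<rfloor>)"
    by (simp add: t_def frac_def algebra_simps)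
  also have "\<dots> = sin (2 * pi * t)"
    by (simp add: sin_add)
  finally have Imq: "Im q = exp (- 2 * pi * Im w) * sin (2 * pi * t)" .
  define y where "y = Im (Ln (1 - q))"
  have y: "\<bar>y\<bar> < pi / 2" unfolding y_def by (rule Re_Ln_pos_lt_imp[OF Re1])
  have y_le: "y \<le> 0" if "Im q \<ge> 0"
    using Im_Ln_pos_lt[OF q1] that y pi_gt_zero unfolding y_def by (auto simp: abs_if split: if_splits)
  have y_ge: "y \<ge> 0" if "Im q \<le> 0"
    using Im_Ln_pos_le[OF q1] that unfolding y_def by auto
  have "- pi < pi * (1 - 2 * t) + 2 * y \<and> pi * (1 - 2 * t) + 2 * y \<le> pi"
  proof -
    \<comment> \<open>The sign of Im q changes at t = 0 and t = 1/2; at both points q is real.\<close>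
    consider "t = 0" | "0 < t" "t < 1 / 2" | "t = 1 / 2" | "1 / 2 < t" using t by linarith
    then show ?thesis
    proof cases
      case 1
      then have "Im q = 0" by (simp add: Imq)
      then show ?thesis using y_le y_ge 1 by auto
    next
      case 2
      have "sin (2 * pi * t) > 0" by (rule sin_gt_zero) (use 2 in auto)
      then have "y \<le> 0" by (intro y_le) (simp add: Imq)
      moreover have "0 < pi * (1 - 2 * t)" "pi * (1 - 2 * t) \<le> pi"
        using 2 by (auto intro: mult_left_le)
      ultimately show ?thesis using y unfolding abs_less_iff by linarith
    next
      case 3
      then have "2 * pi * t = pi" by simp
      then have "Im q = 0" by (simp only: Imq sin_pi mult_zero_right)
      then have "y = 0" using y_le y_ge by auto
      moreover have "pi * (1 - 2 * t) = 0" using 3 by simp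
      ultimately show ?thesis by simp
    next
      case 4
      have "sin (2 * pi * t) < 0" by (rule sin_lt_zero) (use 4 t in auto)
      then have "y \<ge> 0" by (intro y_ge) (simp add: Imq mult_le_0_iff)
      moreover have "pi * (1 - 2 * t) < 0" "pi * (2 * t) < pi * 2"
        using 4 t by (auto simp: mult_less_0_iff)
      then have "- pi < pi * (1 - 2 * t)" by (simp add: algebra_simps)
      ultimately show ?thesis using y \<open>pi * (1 - 2 * t) < 0\<close> unfolding abs_less_iff by linarith
    qed
  qed
  then show "- pi < Im (Ln (- exp (- 2 * of_real pi * \<i> * w)) + 2 * Ln (1 - exp (2 * of_real pi * \<i> * w)))"
    "Im (Ln (- exp (- 2 * of_real pi * \<i> * w)) + 2 * Ln (1 - exp (2 * of_real pi * \<i> * w))) \<le> pi"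
    unfolding Ln_minus_exp by (simp_all add: y_def q_def t_def)
qed

section \<open>The continued integrals and their asymptotics\<close>

lemma I_cont_eqI:
  assumes g: "g holomorphic_on UNIV" and eq: "\<And>z. Re z > - 1 \<Longrightarrow> I_int z a b c d = g z"
  shows "I_cont s a b c d = g s"
proof -
  have "(THE g. g holomorphic_on UNIV \<and> (\<forall>z. Re z > - 1 \<longrightarrow> g z = I_int z a b c d)) = g"
  proof (rule the_equality)
    show "g holomorphic_on UNIV \<and> (\<forall>z. Re z > - 1 \<longrightarrow> g z = I_int z a b c d)"
      using g eq by simp
  next
    fix h assume h: "h holomorphic_on UNIV \<and> (\<forall>z. Re z > - 1 \<longrightarrow> h z = I_int z a b c d)"
    have "h z = g z" for z
    proof (rule analytic_continuation_open[of "{z. Re z > - 1}" UNIV h g])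
      have "0 \<in> {z. Re z > - 1}" by simp
      then show "{z. Re z > - 1} \<noteq> {}" by blast
    qed (use h g eq in \<open>auto simp: open_halfspace_Re_gt\<close>)
    then show "h = g" by blast
  qed
  then show ?thesis by (simp add: I_cont_def)
qed

text \<open>On the half-line the integrand for \<open>c = 1 / 4\<close> is \<open>- \<i>\<close> times the one for \<open>c = 0\<close>, minus
  \<open>Ln (1 - q) * x powr (- s - 1)\<close>. Both integrals exist conditionally for \<open>Re s > -1\<close>, and both
  entire continuations come from towers, so the relation persists for all \<open>s\<close>.\<close>

lemma I_cont_quarter_minus_zero:
  assumes d: "d > 0" and a: "Re a \<noteq> 0" "Im a \<ge> 0" and y: "d * Im a + Im b > 0"
    and tower: "antiderivative_tower d L M"
    and L0: "\<And>x. x \<ge> d \<Longrightarrow> L 0 x = Ln (1 - exp (2 * of_real pi * \<i> * (a * of_real x + b)))"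
  shows "I_cont s a b (1 / 4) d - (- \<i> * I_cont s a b 0 d) = - antiderivative_tower.continuation d L s"
proof -
  interpret L: antiderivative_tower d L M by (rule tower)
  obtain F MF where F: "antiderivative_tower d F MF"
    and F0: "\<And>x. F 0 x = of_real (pi * (1 / 2 - frac (Re a * x + Re b)))"
    using sawtooth_tower[OF a(1) d, where \<beta> = "Re b"] by blast
  interpret F: antiderivative_tower d F MF by (rule F)
  have zero: "I_cont s a b 0 d = F.continuation s"
  proof (rule I_cont_eqI[OF F.holomorphic_continuation])
    fix z :: complex assume z: "Re z > - 1"
    have "of_real pi * (1 / 2 - cfrac (a * of_real x + b) + \<i> * of_real (x * Im a + Im b)) = F 0 x" for x
      by (simp add: cfrac_eq F0 algebra_simps)
    then show "I_int z a b 0 d = F.continuation z"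
      using integral_unique[OF F.has_integral_continuation[OF z]] by (simp add: I_int_def)
  qed
  have quarter: "I_cont s a b (1 / 4) d = - (\<i> * F.continuation s + L.continuation s)"
  proof (rule I_cont_eqI)
    show "(\<lambda>s. - (\<i> * F.continuation s + L.continuation s)) holomorphic_on UNIV"
      by (intro holomorphic_intros F.holomorphic_continuation L.holomorphic_continuation)
  next
    fix z :: complex assume z: "Re z > - 1"
    have split: "1 / 2 * Ln (4 * (sin (of_real pi * (a * of_real x + b)))\<^sup>2) - of_real (pi * \<bar>x * Im a + Im b\<bar>)
        = \<i> * F 0 x + L 0 x" if "x \<ge> d" for x
    proof -
      have "d * Im a \<le> x * Im a" using that a by (intro mult_right_mono) auto
      then have pos: "x * Im a + Im b > 0" using y by linarith
      define w where "w = a * of_real x + b"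
      have w: "Im w = x * Im a + Im b" "Re w = Re a * x + Re b" by (simp_all add: w_def)
      have "Ln (4 * (sin (of_real pi * w))\<^sup>2) =
          of_real (2 * pi * Im w) + \<i> * of_real (pi * (1 - 2 * frac (Re w)))
          + 2 * Ln (1 - exp (2 * of_real pi * \<i> * w))"
        using Ln_4_sin_squared[of w] pos by (simp only: Ln_minus_exp w)
      also have "Ln (1 - exp (2 * of_real pi * \<i> * w)) = L 0 x"
        by (simp only: L0[OF that] w_def)
      also have "\<i> * of_real (pi * (1 - 2 * frac (Re w))) = 2 * \<i> * F 0 x"
        by (simp add: F0 w algebra_simps)
      finally have "Ln (4 * (sin (of_real pi * (a * of_real x + b)))\<^sup>2) =
          of_real (2 * pi * (x * Im a + Im b)) + 2 * \<i> * F 0 x + 2 * L 0 x"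
        by (simp only: w(1)) (simp only: w_def)
      then show ?thesis using pos by (simp add: algebra_simps)
    qed
    have "((\<lambda>x. \<i> * (F 0 x * of_real x powr (- z - 1)) + L 0 x * of_real x powr (- z - 1))
        has_integral (\<i> * F.continuation z + L.continuation z)) {d..}"
      by (intro has_integral_add has_integral_mult_right F.has_integral_continuation
          L.has_integral_continuation z)
    then have "((\<lambda>x. (1 / 2 * Ln (4 * (sin (of_real pi * (a * of_real x + b)))\<^sup>2)
            - of_real (pi * \<bar>x * Im a + Im b\<bar>)) * of_real x powr (- z - 1))
        has_integral (\<i> * F.continuation z + L.continuation z)) {d..}"
      by (rule has_integral_eq[rotated]) (simp only: split atLeast_iff, simp add: algebra_simps)
    moreover have "cos (2 * of_real pi * (1 / 4) :: complex) = 0" "sin (2 * of_real pi * (1 / 4) :: complex) = 1"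
    proof -
      have "2 * of_real pi * (1 / 4) = (of_real (pi / 2) :: complex)" by simp
      then show "cos (2 * of_real pi * (1 / 4) :: complex) = 0" "sin (2 * of_real pi * (1 / 4) :: complex) = 1"
        by (simp_all only: cos_of_real sin_of_real cos_pi_half sin_pi_half of_real_0 of_real_1)
    qed
    ultimately show "I_int z a b (1 / 4) d = - (\<i> * F.continuation z + L.continuation z)"
      unfolding I_int_def by (simp only: integral_unique mult_zero_left mult_1 diff_0)
  qed
  show ?thesis by (simp add: zero quarter)
qed

lemma norm_I_cont_difference_le:
  fixes s :: complex
  defines "m \<equiv> Suc (nat \<lceil>- Re s\<rceil>)"
  assumes d: "d > 0" and a: "Re a \<noteq> 0" "Im a \<ge> 0" and y: "d * Im a + Im b \<ge> 1"
  shows "norm (I_cont s a b (1 / 4) d - (- \<i> * I_cont s a b 0 d))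
    \<le> 2 * exp (- 2 * pi * (d * Im a + Im b)) * (d + 1 / d + 1 / norm a) powr (2 * real m + \<bar>Re s\<bar>)
        * growth_const m s"
proof -
  define e where "e = exp (- 2 * pi * (d * Im a + Im b))"
  define D where "D = d + 1 / d + 1 / norm a"
  have a0: "a \<noteq> 0" using a by auto
  have "pi * 1 \<le> pi * (d * Im a + Im b)" using y by (intro mult_left_mono) auto
  then have "1 \<le> 2 * pi * (d * Im a + Im b)" using pi_ge_two by linarith
  then have "e \<le> exp (- 1)" unfolding e_def by simp
  also have "\<dots> \<le> 1 / 2" using exp_ge_add_one_self[of "1::real"] by (simp add: exp_minus field_simps)
  finally have small: "exp (- 2 * pi * (d * Im a + Im b)) \<le> 1 / 2" by (simp add: e_def)
  obtain L where tower: "antiderivative_tower d L (\<lambda>k. 2 * exp (- 2 * pi * (d * Im a + Im b)) / (2 * pi * norm a) ^ k)"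
    and L0: "\<And>x. x \<ge> d \<Longrightarrow> L 0 x = Ln (1 - exp (2 * of_real pi * \<i> * (a * of_real x + b)))"
    using log_tower[OF d a0 a(2) small] by blast
  interpret L: antiderivative_tower d L "\<lambda>k. 2 * exp (- 2 * pi * (d * Im a + Im b)) / (2 * pi * norm a) ^ k"
    by (rule tower)
  have D: "d \<le> D" "1 / d \<le> D" "1 / norm a \<le> D" using d by (auto simp: D_def)
  have D1: "1 \<le> D"
  proof (cases "d \<ge> 1")
    case True
    then show ?thesis using D by linarith
  next
    case False
    then have "1 \<le> 1 / d" using d by simp
    then show ?thesis using D by linarith
  qed
  have M: "2 * e / (2 * pi * norm a) ^ k \<le> 2 * e * D ^ k" for k
  proof -
    \<comment> \<open>Dropping the factor 2 * pi lets the last summand of D absorb each division by c.\<close>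
    have "1 * norm a \<le> 2 * pi * norm a" using pi_ge_two by (intro mult_right_mono) auto
    then have "1 / (2 * pi * norm a) \<le> 1 / norm a" using a0 by (intro divide_left_mono) auto
    also have "\<dots> \<le> D" by fact
    finally have "(1 / (2 * pi * norm a)) ^ k \<le> D ^ k" by (intro power_mono) auto
    then have "2 * e * (1 / (2 * pi * norm a)) ^ k \<le> 2 * e * D ^ k"
      by (intro mult_left_mono) (auto simp: e_def)
    then show ?thesis by (simp add: power_one_over)
  qed
  have "norm (L.by_parts m 0 s) \<le> (2 * e) * D powr (real 0 + 2 * real m + \<bar>Re s\<bar>) * growth_const m s"
  proof (rule L.norm_by_parts_le[OF D(1,2) D1])
    show "2 * exp (- 2 * pi * (d * Im a + Im b)) / (2 * pi * norm a) ^ k \<le> 2 * e * D ^ k" for k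
      using M[of k] unfolding e_def .
    show "Re s > - real m" unfolding m_def by linarith
  qed (auto simp: e_def m_def)
  moreover have "I_cont s a b (1 / 4) d - (- \<i> * I_cont s a b 0 d) = - L.by_parts m 0 s"
    unfolding m_def L.continuation_def[symmetric]
    using y by (intro I_cont_quarter_minus_zero[OF d a _ tower L0]) auto
  ultimately show ?thesis unfolding e_def D_def norm_minus_cancel by simp
qed

theorem corollaryc:
  fixes s :: complex
    and F :: "'p filter"
    and a b :: "'p \<Rightarrow> complex"
    and d :: "'p \<Rightarrow> real"
  assumes admissible: "\<forall>\<^sub>F p in F. d p > 0 \<and> Re (a p) \<noteq> 0
             \<and> d_plus (a p) (b p) (d p) = d p \<and> d_minus (a p) (b p) (d p) = 1"
    and to_infinity: "filterlim (\<lambda>p. d p * Im (a p) + Im (b p)) at_top F"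
    and nondegenerate: "\<And>\<epsilon>. \<epsilon> > 0 \<Longrightarrow>
          (\<lambda>p. d p + 1 / d p + 1 / cmod (a p)) \<in> O[F](\<lambda>p. exp (\<epsilon> * (d p * Im (a p) + Im (b p))))"
  shows "((\<lambda>p. I_cont s (a p) (b p) (1 / 4) (d p) - (- \<i> * I_cont s (a p) (b p) 0 (d p)))
            \<longlongrightarrow> 0) F
       \<and> (\<exists>\<kappa>>0. (\<lambda>p. cmod (I_cont s (a p) (b p) (1 / 4) (d p)
                              - (- \<i> * I_cont s (a p) (b p) 0 (d p))))
              \<in> O[F](\<lambda>p. exp (- \<kappa> * (d p * Im (a p) + Im (b p)))))"
proof -
  define y where "y p = d p * Im (a p) + Im (b p)" for p
  define D where "D p = d p + 1 / d p + 1 / cmod (a p)" for p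
  define diff where "diff p = I_cont s (a p) (b p) (1 / 4) (d p) - (- \<i> * I_cont s (a p) (b p) 0 (d p))" for p
  define m where "m = Suc (nat \<lceil>- Re s\<rceil>)"
  define N where "N = 2 * real m + \<bar>Re s\<bar>"
  define C where "C = growth_const m s"
  have N: "N > 0" by (simp add: N_def m_def add_pos_nonneg)
  have C: "C \<ge> 0" unfolding C_def by (rule growth_const_nonneg) (unfold m_def, linarith)
  have y1: "\<forall>\<^sub>F p in F. y p \<ge> 1"
    using to_infinity by (simp add: filterlim_at_top y_def)
  \<comment> \<open>With this exponent the N-th power of D grows at most like exp (pi * y), half of the decay exp (- 2 * pi * y).\<close>
  have "D \<in> O[F](\<lambda>p. exp (pi / N * y p))"
    using nondegenerate[of "pi / N"] N by (simp add: D_def[abs_def] y_def)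
  then obtain K where K: "K > 0" "\<forall>\<^sub>F p in F. norm (D p) \<le> K * norm (exp (pi / N * y p))"
    by (elim landau_o.bigE)
  have bound: "\<forall>\<^sub>F p in F. norm (diff p) \<le> 2 * K powr N * C * exp (- pi * y p)"
    using admissible y1 K(2)
  proof eventually_elim
    case (elim p)
    \<comment> \<open>If Im a were negative, d_+ = d would force d * Im a + Im b to be at most 0.\<close>
    have Ima: "Im (a p) \<ge> 0"
    proof (rule ccontr)
      assume neg: "\<not> Im (a p) \<ge> 0"
      then have "- Im (b p) / Im (a p) \<le> d p" using elim(1) by (auto simp: d_plus_def split: if_splits)
      then have "y p \<le> 0" using neg by (simp add: y_def field_simps)
      then show False using elim(2) by simp
    qed
    have "norm (diff p) \<le> 2 * exp (- 2 * pi * y p) * D p powr N * C"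
      unfolding diff_def y_def D_def N_def m_def C_def
      using elim Ima by (intro norm_I_cont_difference_le) (auto simp: y_def)
    also have "D p powr N \<le> (K * exp (pi / N * y p)) powr N"
      using elim N by (intro powr_mono2) (auto simp: D_def)
    also have "\<dots> = K powr N * exp (pi * y p)"
      using K(1) N by (simp add: powr_mult exp_powr_real)
    also have "2 * exp (- 2 * pi * y p) * (K powr N * exp (pi * y p)) * C
        = 2 * K powr N * C * (exp (- 2 * pi * y p) * exp (pi * y p))" by simp
    also have "exp (- 2 * pi * y p) * exp (pi * y p) = exp (- pi * y p)"
      by (simp flip: exp_add)
    finally show ?case using C by (simp add: mult_left_mono mult_right_mono)
  qed
  then have big: "(\<lambda>p. norm (diff p)) \<in> O[F](\<lambda>p. exp (- pi * y p))"
    by (intro bigoI[where c = "2 * K powr N * C"]) simp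
  have "((\<lambda>t. 2 * K powr N * C * exp (- pi * t)) \<longlongrightarrow> 0) at_top"
    by real_asymp
  then have "((\<lambda>p. 2 * K powr N * C * exp (- pi * y p)) \<longlongrightarrow> 0) F"
    using to_infinity unfolding y_def by (rule filterlim_compose)
  with bound have "(diff \<longlongrightarrow> 0) F" by (rule Lim_null_comparison)
  with big show ?thesis
    unfolding diff_def[abs_def] y_def by (intro conjI exI[of _ pi]) auto
qed

end
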